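(* For every $2$-by-$2$ complex matrix $A$, the multi-valued map $f_A^{-1}\colon F(A) \to \mathbb{C}\mathbb{P}^{1}$ is strongly continuous (at every point of $F(A)$).
   Context: For $A \in M_n(\mathbb{C})$ the field of values is $F(A) = \{x^*Ax : x \in \mathbb{C}^n,\ x^*x = 1\} \subset \mathbb{C}$. Let $\mathbb{C}\mathbb{P}^{n-1}$ be the quotient of the unit sphere $\{x \in \mathbb{C}^n : x^*x=1\}$ by multiplication by unimodular scalars, with a metric inducing the quotient topology. Since $(\omega x)^*A(\omega x) = x^*Ax$ for $|\omega|=1$, the map $f_A(x) = x^*Ax$ (with $x$ a unit representative) is a well-defined map $\mathbb{C}\mathbb{P}^{n-1} \to F(A)$, and $f_A^{-1}$ is the multi-valued map sending $z \in F(A)$ to its preimage $f_A^{-1}(z) = \{x \in \mathbb{C}\mathbb{P}^{n-1} : f_A(x) = z\}$. A multi-valued function $g$ from a metric space $(X,d)$ to a metric space $(Y,\rho)$ is strongly continuous at $x \in X$ if for all $y \in g(x)$: for every $\epsilon>0$ there is $\delta>0$ such that for every $x' \in X$ with $d(x,x')<\delta$ there exists $y' \in g(x')$ with $\rho(y,y')<\epsilon$. Here $X = F(A)$ with the usual metric of $\mathbb{C}$. *)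

theory Defs
  imports "HOL-Analysis.Analysis"
begin

definition cinner :: "complex^'n \<Rightarrow> complex^'n \<Rightarrow> complex" where
  "cinner x y = (\<Sum>i\<in>UNIV. cnj (x $ i) * y $ i)"

definition unit_sphere :: "(complex^'n) set" where
  "unit_sphere = {x. cinner x x = 1}"

definition field_of_values :: "complex^'n^'n \<Rightarrow> complex set" where
  "field_of_values A = {cinner x (A *v x) | x. x \<in> unit_sphere}"

definition phase_rel :: "((complex^'n) \<times> (complex^'n)) set" where
  "phase_rel = {(x, y). x \<in> unit_sphere \<and> y \<in> unit_sphere \<and> (\<exists>w. cmod w = 1 \<and> y = w *s x)}"

text \<open>Complex projective space of dimension \<open>CARD('n) - 1\<close>; its points are the
  phase classes of unit vectors.\<close>

definition CP :: "(complex^'n) set set" where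
  "CP = unit_sphere // phase_rel"

definition CP_proj :: "complex^'n \<Rightarrow> (complex^'n) set" where
  "CP_proj x = phase_rel `` {x}"

definition CP_metric :: "((complex^'n) set \<Rightarrow> (complex^'n) set \<Rightarrow> real) \<Rightarrow> bool" where
  "CP_metric \<rho> \<longleftrightarrow> Metric_space CP \<rho> \<and>
     quotient_map (top_of_set unit_sphere) (Metric_space.mtopology CP \<rho>) CP_proj"

text \<open>The form \<open>x \<mapsto> cinner x (A *v x)\<close> is constant on each class
  (lemma \<open>fov_map_CP_proj\<close>), so the image of a class is a singleton.\<close>

definition fov_map :: "complex^'n^'n \<Rightarrow> (complex^'n) set \<Rightarrow> complex" where
  "fov_map A p = the_elem ((\<lambda>x. cinner x (A *v x)) ` p)"

definition fov_inverse :: "complex^'n^'n \<Rightarrow> complex \<Rightarrow> (complex^'n) set set" where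
  "fov_inverse A z = {p \<in> CP. fov_map A p = z}"

text \<open>A multi-valued function is a set-valued one. The target metric space enters only
  through its metric \<open>\<rho>\<close>, the values of \<open>g\<close> being subsets of it.\<close>

definition strongly_continuous_at ::
  "'a set \<Rightarrow> ('a \<Rightarrow> 'a \<Rightarrow> real) \<Rightarrow> ('b \<Rightarrow> 'b \<Rightarrow> real) \<Rightarrow> ('a \<Rightarrow> 'b set) \<Rightarrow> 'a \<Rightarrow> bool" where
  "strongly_continuous_at X d \<rho> g x \<longleftrightarrow>
     (\<forall>y\<in>g x. \<forall>\<epsilon>>0. \<exists>\<delta>>0. \<forall>x'\<in>X. d x x' < \<delta> \<longrightarrow> (\<exists>y'\<in>g x'. \<rho> y y' < \<epsilon>))"

lemma cinner_scale: "cmod w = 1 \<Longrightarrow> cinner (w *s x) (w *s y) = cinner x y"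
proof -
  assume "cmod w = 1"
  then have "cnj w * w = 1"
    by (metis complex_norm_square mult.commute of_real_1 one_power2)
  then have "cnj w * cnj a * (w * b) = cnj a * b" for a b
    by (metis (no_types, opaque_lifting) mult.assoc mult.commute mult_1)
  then show ?thesis unfolding cinner_def vector_smult_component complex_cnj_mult
    by (intro sum.cong refl)
qed

lemma equiv_phase_rel: "equiv unit_sphere phase_rel"
proof (rule equivI)
  show "refl_on unit_sphere phase_rel"
    unfolding refl_on_def phase_rel_def by (auto intro!: exI[of _ 1])
  show "sym phase_rel"
  proof (rule symI)
    fix x y :: "complex^'n" assume "(x, y) \<in> phase_rel"
    then obtain w where w: "x \<in> unit_sphere" "y \<in> unit_sphere" "cmod w = 1" "y = w *s x"
      by (auto simp: phase_rel_def)
    then have "w \<noteq> 0" by auto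
    then have "x = inverse w *s y" using w by simp
    moreover have "cmod (inverse w) = 1" using w by (simp add: norm_inverse)
    ultimately show "(y, x) \<in> phase_rel" using w(1,2) unfolding phase_rel_def by blast
  qed
  show "trans phase_rel"
  proof (rule transI)
    fix x y z :: "complex^'n" assume "(x, y) \<in> phase_rel" "(y, z) \<in> phase_rel"
    then obtain v w where *: "x \<in> unit_sphere" "z \<in> unit_sphere"
      "cmod v = 1" "cmod w = 1" "z = w *s (v *s x)"
      by (auto simp: phase_rel_def)
    have "cmod (w * v) = 1" "z = (w * v) *s x" using * by (simp_all add: norm_mult)
    then show "(x, z) \<in> phase_rel" using *(1,2) unfolding phase_rel_def by blast
  qed
qed (auto simp: phase_rel_def)

lemma fov_map_CP_proj:
  assumes "x \<in> unit_sphere"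
  shows "fov_map A (CP_proj x) = cinner x (A *v x)"
proof -
  have "x \<in> CP_proj x"
    using equiv_class_self[OF equiv_phase_rel assms] by (simp add: CP_proj_def)
  moreover have "cinner y (A *v y) = cinner x (A *v x)" if y: "y \<in> CP_proj x" for y
  proof -
    obtain w where "cmod w = 1" "y = w *s x" using y unfolding CP_proj_def phase_rel_def by blast
    moreover have "A *v (w *s x) = w *s (A *v x)"
      by (simp add: vec_eq_iff matrix_vector_mult_def sum_distrib_left mult_ac)
    ultimately show ?thesis by (simp add: cinner_scale)
  qed
  ultimately have "(\<lambda>x. cinner x (A *v x)) ` CP_proj x = {cinner x (A *v x)}" by blast
  then show ?thesis by (simp add: fov_map_def)
qed

end

theory Submission
  imports Defs
begin

text \<open>The Hopf map sends a unit vector of \<open>\<complex>\<^sup>2\<close> to a point of the unit sphere of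
  \<open>\<complex> \<times> \<real>\<close>, and the form \<open>x\<^sup>*Ax\<close> is a real affine function of that point. The real
  linear part \<open>T\<close> goes from dimension 3 to dimension 2, so it has a kernel. Up to the
  injective restriction of \<open>T\<close> to the orthogonal complement of the kernel, \<open>T\<close> is the orthogonal
  projection \<open>w + h \<mapsto> w\<close>, and a point of the sphere above \<open>w\<close> is moved to one above a nearby
  \<open>w'\<close> by keeping the direction of \<open>h\<close> and changing its length to \<open>sqrt (1 - \<bar>w'\<bar>\<^sup>2)\<close>. Finally
  \<open>2 \<bar>\<langle>x, y\<rangle>\<bar>\<^sup>2 = 1 + hopf x \<bullet> hopf y\<close>, so unit vectors with close Hopf images are close up to
  a phase.\<close>

section \<open>Linear maps on the unit sphere\<close>

lemma linear_open_on_sphere: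
  fixes T :: "'a::euclidean_space \<Rightarrow> 'b::euclidean_space"
  assumes T: "linear T" and ninj: "\<not> inj T" and p: "norm p = 1" and \<epsilon>: "\<epsilon> > 0"
  shows "\<exists>\<delta>>0. \<forall>q. norm q = 1 \<longrightarrow> dist (T p) (T q) < \<delta> \<longrightarrow>
           (\<exists>p'. norm p' = 1 \<and> T p' = T q \<and> dist p p' < \<epsilon>)"
proof -
  define K where "K = {x. T x = 0}"
  define W where "W = orthogonal_comp K"
  have K: "subspace K"
    unfolding K_def by (rule linear_subspace_kernel[OF T])
  have W: "subspace W"
    unfolding W_def by (rule subspace_orthogonal_comp)
  have decomp: "\<exists>w h. w \<in> W \<and> h \<in> K \<and> x = w + h" for x
  proof -
    obtain h w where "h \<in> span K" "\<And>v. v \<in> span K \<Longrightarrow> orthogonal w v" "x = h + w"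
      using orthogonal_subspace_decomp_exists[of K x] by blast
    moreover have "span K = K"
      using K by (simp add: span_eq_iff)
    ultimately show ?thesis
      unfolding W_def orthogonal_comp_def
      by (intro exI[of _ w] exI[of _ h]) (auto simp: orthogonal_commute)
  qed
  have pyth: "(norm (w + h))\<^sup>2 = (norm w)\<^sup>2 + (norm h)\<^sup>2" if "w \<in> W" "h \<in> K" for w h
    using that norm_add_Pythagorean[of w h]
    by (auto simp: W_def orthogonal_comp_def orthogonal_commute)
  have T_decomp: "T (w + h) = T w" if "h \<in> K" for w h
    using that by (simp add: K_def linear_add[OF T])
  \<comment> \<open>\<open>T\<close> is injective on \<open>W\<close>, hence bounded below there, so
    close images force close \<open>W\<close>-components.\<close>
  have "w = 0" if "w \<in> W" "T w = 0" for w
    using that by (force simp: W_def K_def orthogonal_comp_def orthogonal_self)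
  then obtain e where e: "e > 0" "\<And>w. w \<in> W \<Longrightarrow> e * norm w \<le> norm (T w)"
    using injective_imp_isometric[OF closed_subspace[OF W] W linear_conv_bounded_linear[THEN iffD1, OF T]]
    by metis
  obtain w h where wh: "w \<in> W" "h \<in> K" "p = w + h"
    using decomp by blast
  obtain k where k: "k \<in> K" "k \<noteq> 0"
    using ninj linear_injective_0[OF T] by (auto simp: K_def)
  \<comment> \<open>If \<open>h = 0\<close> there is no direction to keep, and any unit vector of
    the nontrivial kernel will do.\<close>
  obtain u where u: "u \<in> K" "norm u = 1" "h = norm h *\<^sub>R u"
  proof (cases "h = 0")
    case True
    then show ?thesis
      using that[of "sgn k"] k K by (simp add: sgn_div_norm subspace_scale norm_sgn)
  next
    case False
    then show ?thesis
      using that[of "sgn h"] wh K by (simp add: sgn_div_norm subspace_scale norm_sgn)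
  qed
  \<comment> \<open>The length a kernel component needs in order to put a vector with
    \<open>W\<close>-component \<open>v\<close> on the sphere.\<close>
  define g where "g = (\<lambda>v::'a. sqrt (1 - (norm v)\<^sup>2))"
  have gw: "g w = norm h"
    using pyth[OF wh(1,2)] p wh(3) by (simp add: g_def real_sqrt_unique)
  \<comment> \<open>Real \<open>sqrt\<close> is continuous at 0 too, so the boundary case
    \<open>norm w = 1\<close> is covered.\<close>
  have "isCont g w"
    unfolding g_def by (intro continuous_intros)
  then obtain \<eta> where \<eta>: "\<eta> > 0" "\<And>v. dist v w < \<eta> \<Longrightarrow> dist (g v) (g w) < \<epsilon> / 2"
    unfolding continuous_at_eps_delta using \<epsilon> by (metis half_gt_zero dist_norm real_norm_def)
  show ?thesis
  proof (rule exI, intro conjI allI impI)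
    \<comment> \<open>The factor \<open>e\<close> passes from images to \<open>W\<close>-components;
      half of \<epsilon> goes to the \<open>W\<close>-part and half to the kernel part.\<close>
    show "e * min \<eta> (\<epsilon> / 2) > 0"
      using e \<eta> \<epsilon> by simp
    fix q :: 'a assume q: "norm q = 1" "dist (T p) (T q) < e * min \<eta> (\<epsilon> / 2)"
    obtain w' h' where wh': "w' \<in> W" "h' \<in> K" "q = w' + h'"
      using decomp by blast
    have "e * dist w' w \<le> norm (T (w' - w))"
      using e(2)[OF subspace_diff[OF W wh'(1) wh(1)]] by (simp add: dist_norm)
    also have "\<dots> = dist (T p) (T q)"
      using T_decomp wh wh' by (simp add: linear_diff[OF T] dist_norm norm_minus_commute)
    finally have d: "dist w' w < min \<eta> (\<epsilon> / 2)"
      using q(2) e(1) by (smt (verit) mult_less_cancel_left_pos)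
    \<comment> \<open>As \<open>w'\<close> comes from a point of the sphere, the radicand in
      \<open>g w'\<close> is nonnegative.\<close>
    have le: "(norm w')\<^sup>2 \<le> 1"
      using pyth[OF wh'(1,2)] q(1) wh'(3) by (metis le_add_same_cancel1 one_power2 zero_le_power2)
    define p' where "p' = w' + g w' *\<^sub>R u"
    have gu: "g w' *\<^sub>R u \<in> K"
      using K u(1) by (rule subspace_scale)
    have "(norm p')\<^sup>2 = 1"
      unfolding p'_def pyth[OF wh'(1) gu] using u(2) le by (simp add: g_def)
    then have "norm p' = 1"
      by (smt (verit) norm_ge_zero power2_eq_1_iff)
    moreover have "T p' = T q"
      unfolding p'_def wh'(3) using T_decomp gu wh'(2) by simp
    moreover have "dist p p' < \<epsilon>"
    proof -
      have "p' - p = (w' - w) + (g w' - g w) *\<^sub>R u"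
        unfolding p'_def wh(3) gw using u(3) by (simp add: algebra_simps)
      then have "dist p p' \<le> dist w' w + dist (g w') (g w)"
        using norm_triangle_ineq[of "w' - w" "(g w' - g w) *\<^sub>R u"] u(2)
        by (simp add: dist_norm norm_minus_commute[of p])
      also have "\<dots> < \<epsilon>"
        using d \<eta>(2)[of w'] by simp
      finally show ?thesis .
    qed
    ultimately show "\<exists>p'. norm p' = 1 \<and> T p' = T q \<and> dist p p' < \<epsilon>"
      by blast
  qed
qed

section \<open>The Hopf map\<close>

lemma cinner_2: "cinner x (y :: complex^2) = cnj (x $ 1) * y $ 1 + cnj (x $ 2) * y $ 2"
  by (simp add: cinner_def sum_2)

lemma cinner_self: "cinner x x = of_real ((norm x)\<^sup>2)"
proof -
  have "cinner x x = of_real (\<Sum>i\<in>UNIV. (norm (x $ i))\<^sup>2)"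
    unfolding cinner_def of_real_sum
    by (intro sum.cong refl) (simp only: mult.commute[of "cnj _"] complex_norm_square)
  then show ?thesis
    by (simp add: norm_vec_def L2_set_def sum_nonneg)
qed

lemma unit_sphere_eq: "unit_sphere = {x :: complex^'n. norm x = 1}"
proof -
  have "complex_of_real ((norm x)\<^sup>2) = 1 \<longleftrightarrow> norm x = 1" for x :: "complex^'n"
    by (metis norm_ge_zero of_real_eq_1_iff one_power2 power2_eq_iff_nonneg zero_le_one)
  then show ?thesis
    by (simp only: unit_sphere_def cinner_self)
qed

lemma Re_cinner: "Re (cinner x y) = x \<bullet> y"
  by (simp add: cinner_def inner_vec_def inner_complex_def)

lemma cinner_scale_right: "cinner x (w *s y) = w * cinner x y"
  by (simp add: cinner_def sum_distrib_left mult_ac)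

lemma unit_sphere_scale: "x \<in> unit_sphere \<Longrightarrow> cmod w = 1 \<Longrightarrow> w *s x \<in> unit_sphere"
  by (simp add: unit_sphere_def cinner_scale)

text \<open>For unit \<open>x\<close> these are the (2,1) and (1,1) entries of the traceless
  Hermitian matrix 2xx* - I, in which the phase of \<open>x\<close> cancels.\<close>

definition hopf :: "complex^2 \<Rightarrow> complex \<times> real" where
  "hopf x = (2 * cnj (x $ 1) * x $ 2, (cmod (x $ 1))\<^sup>2 - (cmod (x $ 2))\<^sup>2)"

lemma unit_sphere_2: "x \<in> unit_sphere \<longleftrightarrow> (cmod (x $ 1))\<^sup>2 + (cmod ((x :: complex^2) $ 2))\<^sup>2 = 1"
  by (simp add: unit_sphere_eq norm_vec_def L2_set_def sum_2)

lemma norm_hopf: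
  assumes "x \<in> unit_sphere"
  shows "norm (hopf x) = 1"
proof -
  have "(norm (hopf x))\<^sup>2 = ((cmod (x $ 1))\<^sup>2 + (cmod (x $ 2))\<^sup>2)\<^sup>2"
    by (simp add: hopf_def norm_Pair norm_mult power_mult_distrib) (simp add: power2_eq_square algebra_simps)
  then have "(norm (hopf x))\<^sup>2 = 1"
    using assms by (simp add: unit_sphere_2)
  then show ?thesis
    by (smt (verit) norm_ge_zero power2_eq_1_iff)
qed

lemma hopf_surj:
  assumes "norm q = 1"
  obtains x where "x \<in> unit_sphere" "hopf x = q"
proof -
  obtain u c where q: "q = (u, c)" by fastforce
  have eq: "(cmod u)\<^sup>2 + c\<^sup>2 = 1"
    using assms by (simp add: q norm_Pair)
  show ?thesis
  proof (cases "c = -1")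
    case True
    then have "u = 0" using eq by simp
    then show ?thesis
      using that[of "vector [0, 1]"] True by (simp add: q hopf_def unit_sphere_2)
  next
    case False
    have "c\<^sup>2 \<le> 1" using eq by (smt (verit) zero_le_power2)
    then have "-1 \<le> c" by (simp add: abs_square_le_1)
    with False have c: "1 + c > 0" by simp
    \<comment> \<open>Fix the phase by making the first coordinate positive. Its square is forced by
      the sum 1 and the difference \<open>c\<close> of the squared moduli; the second coordinate
      then solves 2r \<open>x $ 2\<close> = \<open>u\<close>.\<close>
    define r where "r = sqrt ((1 + c) / 2)"
    have r: "r > 0" "r\<^sup>2 = (1 + c) / 2" using c by (simp_all add: r_def)
    have u2: "(cmod u)\<^sup>2 = (1 + c) * (1 - c)" using eq by (simp add: power2_eq_square algebra_simps)
    define x :: "complex^2" where "x = vector [of_real r, u / of_real (2 * r)]"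
    have n1: "(cmod (x $ 1))\<^sup>2 = (1 + c) / 2"
      using r by (simp add: x_def)
    have n2: "(cmod (x $ 2))\<^sup>2 = (1 - c) / 2"
      using c by (simp add: x_def norm_divide norm_mult power_divide power_mult_distrib r u2 field_simps)
    have "x \<in> unit_sphere"
      unfolding unit_sphere_2 n1 n2 by (simp add: field_simps)
    moreover have "hopf x = q"
      unfolding hopf_def n1 n2 q using r(1) by (simp add: x_def field_simps)
    ultimately show ?thesis using that by blast
  qed
qed

lemma cmod_cinner_hopf:
  assumes "x \<in> unit_sphere" "y \<in> unit_sphere"
  shows "2 * (cmod (cinner x y))\<^sup>2 = 1 + hopf x \<bullet> hopf y"
proof -
  \<comment> \<open>Homogeneous form of the identity, valid for all vectors.\<close>
  have "2 * (cmod (cinner x y))\<^sup>2 =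
      ((cmod (x $ 1))\<^sup>2 + (cmod (x $ 2))\<^sup>2) * ((cmod (y $ 1))\<^sup>2 + (cmod (y $ 2))\<^sup>2) + hopf x \<bullet> hopf y"
    by (simp add: cinner_2 hopf_def inner_complex_def cmod_power2)
      (simp add: power2_eq_square algebra_simps)
  then show ?thesis
    using assms by (simp add: unit_sphere_2)
qed

lemma hopf_lift_near:
  assumes x: "x \<in> unit_sphere" and q: "norm q = 1"
  obtains y where "y \<in> unit_sphere" "hopf y = q" "(dist x y)\<^sup>2 \<le> (dist (hopf x) q)\<^sup>2"
proof -
  obtain y0 where y0: "y0 \<in> unit_sphere" "hopf y0 = q"
    using hopf_surj[OF q] .
  define s where "s = cinner x y0"
  \<comment> \<open>The phase that makes the inner product of \<open>x\<close> with
    \<open>w *s y0\<close> real and nonnegative, which minimizes the distance to \<open>x\<close>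
    within the class of \<open>y0\<close>.\<close>
  define w where "w = (if s = 0 then 1 else cnj (sgn s))"
  have w: "cmod w = 1"
    by (simp add: w_def norm_sgn)
  have ws: "w * s = of_real (cmod s)"
    by (simp add: w_def sgn_eq complex_norm_square[symmetric] power2_eq_square field_simps)
  define y where "y = w *s y0"
  have y: "y \<in> unit_sphere"
    unfolding y_def using y0(1) w by (rule unit_sphere_scale)
  have "cnj w * w = 1"
    using w by (metis complex_norm_square mult.commute of_real_1 one_power2)
  then have "hopf y = q"
    by (simp add: y0(2)[symmetric] y_def hopf_def norm_mult w mult_ac)
  have ip: "x \<bullet> y = cmod s"
    using Re_cinner[of x y] by (simp add: y_def cinner_scale_right s_def[symmetric] ws)
  have n: "norm x = 1" "norm y = 1"
    using x y by (simp_all add: unit_sphere_eq)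
  have "x \<bullet> y \<le> 1"
    using norm_cauchy_schwarz[of x y] n by simp
  have "(dist x y)\<^sup>2 = 2 - 2 * (x \<bullet> y)"
    using n by (simp add: dist_norm power2_norm_eq_inner inner_diff inner_commute norm_eq_1)
  \<comment> \<open>With t = \<open>x \<bullet> y\<close> in [0,1], the difference of the two sides
    is 2(1 - t)(1 + 2t).\<close>
  also have "\<dots> \<le> 4 * (1 - (x \<bullet> y)\<^sup>2)"
    using mult_nonneg_nonneg[of "1 - x \<bullet> y" "1 + 2 * (x \<bullet> y)"] \<open>x \<bullet> y \<le> 1\<close> ip
    by (simp add: power2_eq_square algebra_simps)
  also have "\<dots> = 2 - 2 * (hopf x \<bullet> q)"
    using cmod_cinner_hopf[OF x y0(1)] by (simp add: ip s_def y0(2))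
  also have "\<dots> = (dist (hopf x) q)\<^sup>2"
    using norm_hopf[OF x] q
    by (simp add: dist_norm power2_norm_eq_inner inner_diff inner_commute norm_eq_1)
  finally show ?thesis
    using that y \<open>hopf y = q\<close> by blast
qed

section \<open>Strong continuity\<close>

text \<open>This is tr(AB)/2 for the traceless Hermitian B with (2,1) entry \<open>fst q\<close> and
  (1,1) entry \<open>snd q\<close>. With B = 2xx* - I it is the form minus the constant
  tr(A)/2.\<close>

definition hopf_form :: "complex^2^2 \<Rightarrow> complex \<times> real \<Rightarrow> complex" where
  "hopf_form A q = (A $ 1 $ 2 * fst q + A $ 2 $ 1 * cnj (fst q) + (A $ 1 $ 1 - A $ 2 $ 2) * of_real (snd q)) / 2"

lemma linear_hopf_form: "linear (hopf_form A)"
  by (rule linearI) (simp_all add: hopf_form_def field_simps scaleR_conv_of_real)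

lemma not_inj_hopf_form: "\<not> inj (hopf_form A)"
proof
  assume "inj (hopf_form A)"
  then have "DIM(complex \<times> real) \<le> DIM(complex)"
    using linear_hopf_form by (metis dim_UNIV dim_image_eq dim_subset_UNIV inj_on_subset subset_UNIV)
  then show False by simp
qed

lemma form_eq_hopf_form:
  assumes "x \<in> unit_sphere"
  shows "cinner x (A *v x) = (A $ 1 $ 1 + A $ 2 $ 2) / 2 + hopf_form A (hopf x)"
proof -
  have 1: "of_real ((cmod (x $ 1))\<^sup>2) + of_real ((cmod (x $ 2))\<^sup>2) = (1 :: complex)"
    using assms unfolding unit_sphere_2 by (metis of_real_1 of_real_add)
  \<comment> \<open>The trace is weighted by the squared norm of \<open>x\<close> so that both sides
    are quadratic in \<open>x\<close>.\<close>
  have "2 * cinner x (A *v x) = (A $ 1 $ 1 + A $ 2 $ 2) * (of_real ((cmod (x $ 1))\<^sup>2) + of_real ((cmod (x $ 2))\<^sup>2))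
      + 2 * hopf_form A (hopf x)"
    unfolding hopf_form_def hopf_def fst_conv snd_conv of_real_diff complex_norm_square cinner_2
    by (simp add: matrix_vector_mult_def sum_2 field_simps)
  then show ?thesis
    unfolding 1 by (simp add: field_simps)
qed

text \<open>Strong continuity on the unit sphere, before passing to phase classes.\<close>

lemma form_lift_near:
  fixes A :: "complex^2^2"
  assumes x: "x \<in> unit_sphere" and \<epsilon>: "\<epsilon> > 0"
  shows "\<exists>\<delta>>0. \<forall>z\<in>field_of_values A. dist (cinner x (A *v x)) z < \<delta> \<longrightarrow>
           (\<exists>y\<in>unit_sphere. cinner y (A *v y) = z \<and> dist x y < \<epsilon>)"
proof -
  obtain \<delta> where \<delta>: "\<delta> > 0" "\<And>q. \<lbrakk>norm q = 1; dist (hopf_form A (hopf x)) (hopf_form A q) < \<delta>\<rbrakk> \<Longrightarrow>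
      \<exists>q'. norm q' = 1 \<and> hopf_form A q' = hopf_form A q \<and> dist (hopf x) q' < \<epsilon>"
    using linear_open_on_sphere[OF linear_hopf_form not_inj_hopf_form norm_hopf[OF x] \<epsilon>] by metis
  show ?thesis
  proof (intro exI conjI ballI impI)
    show "\<delta> > 0" by fact
    fix z assume "z \<in> field_of_values A" and d: "dist (cinner x (A *v x)) z < \<delta>"
    then obtain v where v: "v \<in> unit_sphere" "z = cinner v (A *v v)"
      by (auto simp: field_of_values_def)
    \<comment> \<open>The trace term is the same for \<open>x\<close> and \<open>v\<close> and
      cancels.\<close>
    have "dist (hopf_form A (hopf x)) (hopf_form A (hopf v)) < \<delta>"
      using d v x by (simp add: form_eq_hopf_form)
    then obtain q where q: "norm q = 1" "hopf_form A q = hopf_form A (hopf v)" "dist (hopf x) q < \<epsilon>"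
      using \<delta>(2) norm_hopf[OF v(1)] by blast
    obtain y where y: "y \<in> unit_sphere" "hopf y = q" "(dist x y)\<^sup>2 \<le> (dist (hopf x) q)\<^sup>2"
      using hopf_lift_near[OF x q(1)] .
    have "dist x y < \<epsilon>"
      using power2_le_imp_le[OF y(3)] q(3) by simp
    moreover have "cinner y (A *v y) = z"
      using y v q by (simp add: form_eq_hopf_form)
    ultimately show "\<exists>y\<in>unit_sphere. cinner y (A *v y) = z \<and> dist x y < \<epsilon>"
      using y(1) by blast
  qed
qed

text \<open>\<rho> is given only through the topology it induces, so nearness of classes comes from
  continuity of the quotient map.\<close>

lemma CP_metric_proj_near:
  assumes \<rho>: "CP_metric \<rho>" and x: "x \<in> unit_sphere" and \<epsilon>: "\<epsilon> > 0"
  shows "\<exists>\<eta>>0. \<forall>y\<in>unit_sphere. dist x y < \<eta> \<longrightarrow> \<rho> (CP_proj x) (CP_proj y) < \<epsilon>"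
proof -
  interpret Metric_space CP \<rho>
    using \<rho> by (simp add: CP_metric_def)
  have cont: "continuous_map (top_of_set unit_sphere) mtopology CP_proj"
    using \<rho> by (simp add: CP_metric_def quotient_imp_continuous_map)
  have "CP_proj x \<in> CP"
    using x by (simp add: CP_def CP_proj_def quotientI)
  then have "CP_proj x \<in> mball (CP_proj x) \<epsilon>"
    using \<epsilon> by simp
  moreover have "openin (top_of_set unit_sphere) {y \<in> unit_sphere. CP_proj y \<in> mball (CP_proj x) \<epsilon>}"
    using openin_continuous_map_preimage[OF cont openin_mball] by simp
  ultimately show ?thesis
    using x unfolding openin_euclidean_subtopology_iff by (force simp: dist_commute)
qed

theorem corollary6:
  fixes A :: "complex^2^2"
    and \<rho> :: "(complex^2) set \<Rightarrow> (complex^2) set \<Rightarrow> real"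
  assumes "CP_metric \<rho>"
  shows "\<forall>z\<in>field_of_values A.
           strongly_continuous_at (field_of_values A) dist \<rho> (fov_inverse A) z"
  unfolding strongly_continuous_at_def
proof (intro ballI allI impI)
  fix z p and \<epsilon> :: real
  assume p: "p \<in> fov_inverse A z" and \<epsilon>: "\<epsilon> > 0"
  then obtain x where x: "x \<in> unit_sphere" "p = CP_proj x"
    by (auto simp: fov_inverse_def CP_def CP_proj_def elim: quotientE)
  have z: "z = cinner x (A *v x)"
    using p x by (simp add: fov_inverse_def fov_map_CP_proj)
  \<comment> \<open>Tolerances are chosen backwards: \<epsilon> between classes, \<eta> between unit
    vectors, \<delta> in the field of values.\<close>
  obtain \<eta> where \<eta>: "\<eta> > 0" "\<And>y. \<lbrakk>y \<in> unit_sphere; dist x y < \<eta>\<rbrakk> \<Longrightarrow> \<rho> p (CP_proj y) < \<epsilon>"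
    using CP_metric_proj_near[OF assms x(1) \<epsilon>] x(2) by blast
  obtain \<delta> where "\<delta> > 0" and \<delta>: "\<And>z'. \<lbrakk>z' \<in> field_of_values A; dist z z' < \<delta>\<rbrakk> \<Longrightarrow>
      \<exists>y\<in>unit_sphere. cinner y (A *v y) = z' \<and> dist x y < \<eta>"
    using form_lift_near[OF x(1) \<eta>(1), of A] z by blast
  have "\<exists>p'\<in>fov_inverse A z'. \<rho> p p' < \<epsilon>" if z': "z' \<in> field_of_values A" "dist z z' < \<delta>" for z'
  proof -
    obtain y where y: "y \<in> unit_sphere" "cinner y (A *v y) = z'" "dist x y < \<eta>"
      using \<delta>[OF z'] by blast
    have "CP_proj y \<in> fov_inverse A z'"
      using y by (simp add: fov_inverse_def fov_map_CP_proj CP_def) (simp add: CP_proj_def quotientI)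
    then show ?thesis
      using \<eta>(2) y by blast
  qed
  with \<open>\<delta> > 0\<close> show "\<exists>\<delta>>0. \<forall>z'\<in>field_of_values A. dist z z' < \<delta> \<longrightarrow> (\<exists>p'\<in>fov_inverse A z'. \<rho> p p' < \<epsilon>)"
    by blast
qed

end
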